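(* Let the weight vectors $\bm W_{\bm z},\bm W_{\mathcal R},\bm W_{\bm u}^H$ and the coarse-grid regularization vector $\bm u_H$ be as defined in the context. Then a proximal point update on the coarse surrogate $\widetilde\Phi_{H,k}$, initialized at $\bm z_{H,k}'=\bm I_h^H(\bm W_{\bm z}\odot\bm z_k')$, provides a descent direction for the fine-grid surrogate $\widetilde\Phi_k$ at $\bm z_k'\in\mathbb{C}^{m^2}$. That is, $$\nabla_{\bm z_k}\widetilde\Phi_k(\bm z_k';\bm z_k^{(j)})^*\,(\bm I_H^h\bm e_{H,k})\le0,$$ where $\bm I_H^h\bm e_{H,k}=\bm I_H^h(\widehat{\bm z_{H,k}}-\bm z_{H,k}')$ and $\widehat{\bm z_{H,k}}$ solves $$\widehat{\bm z_{H,k}}=\operatorname{argmin}_{\bm z_{H,k}}\ \widetilde\Phi_{H,k}(\bm z_{H,k};\bm z_k^{(j)})+\tfrac12\bm u_H^\top|\bm z_{H,k}-\bm z_{H,k}'|^2.$$ Moreover, $$\bm e_{H,k}=-|\bm Q_H|^2\oslash(\bm I_h^H|\bm Q|^2)\oslash(\bm u_H+|\bm Q_H|^2)\odot\big(\bm I_h^H\nabla_{\bm z_k}\widetilde\Phi_k(\bm z_k';\bm z_k^{(j)})\big).$$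
   Context: Grids. $m$ is even. Indices of vectors in $\mathbb{C}^{m^2}$ (fine grid) are identified with the points of an $m\times m$ grid, partitioned into $(m/2)^2$ bins $\mathcal B_r$, the $2\times2$ blocks; $r$ indexes vectors in $\mathbb{C}^{(m/2)^2}$ (coarse grid). Restriction: $(\bm I_h^H\bm w)_r=\frac14\sum_{i\in\mathcal B_r}\bm w_i$. Prolongation: $\bm I_H^h=4(\bm I_h^H)^\top$, i.e. $(\bm I_H^h\bm v)_i=\bm v_r$ for $i\in\mathcal B_r$. $\odot,\oslash$ are entrywise product and division; $|\cdot|$, $|\cdot|^2$, $\sqrt\cdot$, $\exp$, $\theta$ (principal argument) act entrywise; $^*$ is conjugate transpose. Data. $\bm Q\in\mathbb{C}^{m^2}$ is the probe; $\bm d_k\in\mathbb{R}^{m^2}$ is the vector of measured intensities (nonnegative entries) for scanning region $k$; $\bm z_k^{(j)}\in\mathbb{C}^{m^2}$ is the current ($j$-th) iterate in scanning region $k$; $\mathcal F$ is the two-dimensional discrete Fourier transform on $\mathbb{C}^{m^2}$; $\mathcal R_k(\bm z_k^{(j)})=\mathcal F^{-1}\big(\sqrt{\bm d_k}\odot\exp(i\theta(\mathcal F(\bm Q\odot\bm z_k^{(j)})))\big)\in\mathbb{C}^{m^2}$, where at an index with $[\mathcal F(\bm Q\odot\bm z_k^{(j)})]_r=0$ the angle is $0$ if $j=0$ and otherwise the angle used at the previous iterate. The fine-grid regularization vector $\bm u\in\mathbb{R}^{m^2}$ is chosen so that $\bm u+|\bm Q|^2$ is strictly positive entrywise. Weights: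 $$\bm W_{\bm z}=|\bm Q|^2\oslash(\bm I_H^h\bm I_h^H|\bm Q|^2),\quad \bm W_{\mathcal R}=(\bm I_H^h\bm Q_H)\odot\bm W_{\bm z}\oslash\bm Q,\quad \bm W_{\bm u}^H=|\bm Q_H|^2\oslash(\bm I_h^H|\bm Q|^2),$$ where $\bm W_{\bm z}$ is chosen so that the division by $\bm Q$ in $\bm W_{\mathcal R}$ cancels, i.e. $\bm W_{\mathcal R}=(\bm I_H^h\bm Q_H)\odot\overline{\bm Q}\oslash(\bm I_H^h\bm I_h^H|\bm Q|^2)$. Coarse quantities: $\bm Q_H=\bm I_h^H\bm Q$, $\mathcal R_{H,k}(\bm z_k^{(j)})=\bm I_h^H(\bm W_{\mathcal R}\odot\mathcal R_k(\bm z_k^{(j)}))$, $\bm u_H=\bm W_{\bm u}^H\odot\bm I_h^H\bm u$. Objectives: $\widetilde\Phi_k(\bm z_k;\bm z_k^{(j)})=\frac12\|\bm Q\odot\bm z_k-\mathcal R_k(\bm z_k^{(j)})\|_2^2$ for $\bm z_k\in\mathbb{C}^{m^2}$ and $\widetilde\Phi_{H,k}(\bm z_{H,k};\bm z_k^{(j)})=\frac12\|\bm Q_H\odot\bm z_{H,k}-\mathcal R_{H,k}(\bm z_k^{(j)})\|_2^2$ for $\bm z_{H,k}\in\mathbb{C}^{(m/2)^2}$. Gradients are complex gradients with respect to the first argument: for $\bm z=\bm x+i\bm y$, $\nabla_{\bm z}f=\nabla_{\bm x}f+i\nabla_{\bm y}f$. *)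

theory Defs
  imports "HOL-Analysis.Analysis" "HOL-Library.Complex_Order"
begin

(* A vector indexed by the points of an n x n grid is a function on nat * nat of which only the
   values on grid n matter.  Where vectors must be compared or ranged over (the argmin), they are
   taken in cvecs n, whose members are fixed outside the grid. *)

type_synonym 'a gvec = "nat \<times> nat \<Rightarrow> 'a"

definition grid :: "nat \<Rightarrow> (nat \<times> nat) set" where
  "grid n = {..<n} \<times> {..<n}"

definition cvecs :: "nat \<Rightarrow> complex gvec set" where
  "cvecs n = (grid n \<rightarrow>\<^sub>E UNIV)"

definition bin :: "nat \<times> nat \<Rightarrow> (nat \<times> nat) set" where
  "bin r = {2 * fst r, 2 * fst r + 1} \<times> {2 * snd r, 2 * snd r + 1}"

definition bin_of :: "nat \<times> nat \<Rightarrow> nat \<times> nat" where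
  "bin_of i = (fst i div 2, snd i div 2)"

lemma mem_bin_iff: "i \<in> bin r \<longleftrightarrow> r = bin_of i"
  by (cases i; cases r) (auto simp: bin_def bin_of_def)

definition restr :: "'a::field gvec \<Rightarrow> 'a gvec" where
  "restr w r = (1 / 4) * (\<Sum>i\<in>bin r. w i)"

definition prolong :: "'a gvec \<Rightarrow> 'a gvec" where
  "prolong v i = v (bin_of i)"

definition abs2 :: "complex gvec \<Rightarrow> real gvec" where
  "abs2 w i = (cmod (w i))\<^sup>2"

(* Unnormalised DFT and its inverse.  Another normalisation of the DFT would only rescale the
   intensities d by a positive constant in data_proj below. *)

definition dft :: "nat \<Rightarrow> complex gvec \<Rightarrow> complex gvec" where
  "dft m w p = (\<Sum>i\<in>grid m. w i *
     exp (- (2 * complex_of_real pi * \<i> * of_nat (fst p * fst i + snd p * snd i)) / of_nat m))"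

definition idft :: "nat \<Rightarrow> complex gvec \<Rightarrow> complex gvec" where
  "idft m w i = 1 / (of_nat m)\<^sup>2 * (\<Sum>p\<in>grid m. w p *
     exp (2 * complex_of_real pi * \<i> * of_nat (fst p * fst i + snd p * snd i) / of_nat m))"

(* zs is the sequence of iterates of one scanning region.  Where the transform vanishes, the angle
   of the previous iterate is kept. *)

fun phase :: "nat \<Rightarrow> complex gvec \<Rightarrow> (nat \<Rightarrow> complex gvec) \<Rightarrow> nat \<Rightarrow> real gvec" where
  "phase m Q zs 0 p =
     (let w = dft m (\<lambda>i. Q i * zs 0 i) p in if w = 0 then 0 else Arg w)"
| "phase m Q zs (Suc j) p =
     (let w = dft m (\<lambda>i. Q i * zs (Suc j) i) p in if w = 0 then phase m Q zs j p else Arg w)"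

definition data_proj ::
    "nat \<Rightarrow> complex gvec \<Rightarrow> real gvec \<Rightarrow> (nat \<Rightarrow> complex gvec) \<Rightarrow> nat \<Rightarrow> complex gvec" where
  "data_proj m Q d zs j =
     idft m (\<lambda>p. complex_of_real (sqrt (d p)) * exp (\<i> * complex_of_real (phase m Q zs j p)))"

definition QH :: "complex gvec \<Rightarrow> complex gvec" where
  "QH Q = restr Q"

definition Wz :: "complex gvec \<Rightarrow> real gvec" where
  "Wz Q i = abs2 Q i / prolong (restr (abs2 Q)) i"

(* The formula in which the division by Q has been cancelled against |Q|^2, so that Q may vanish
   at individual grid points. *)

definition WR :: "complex gvec \<Rightarrow> complex gvec" where
  "WR Q i = prolong (QH Q) i * cnj (Q i) / complex_of_real (prolong (restr (abs2 Q)) i)"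

definition WuH :: "complex gvec \<Rightarrow> real gvec" where
  "WuH Q r = abs2 (QH Q) r / restr (abs2 Q) r"

definition uH :: "complex gvec \<Rightarrow> real gvec \<Rightarrow> real gvec" where
  "uH Q u r = WuH Q r * restr u r"

definition data_projH ::
    "nat \<Rightarrow> complex gvec \<Rightarrow> real gvec \<Rightarrow> (nat \<Rightarrow> complex gvec) \<Rightarrow> nat \<Rightarrow> complex gvec" where
  "data_projH m Q d zs j = restr (\<lambda>i. WR Q i * data_proj m Q d zs j i)"

definition Phi ::
    "nat \<Rightarrow> complex gvec \<Rightarrow> real gvec \<Rightarrow> (nat \<Rightarrow> complex gvec) \<Rightarrow> nat \<Rightarrow> complex gvec \<Rightarrow> real"
  where
  "Phi m Q d zs j z =
     1 / 2 * (L2_set (\<lambda>i. cmod (Q i * z i - data_proj m Q d zs j i)) (grid m))\<^sup>2"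

definition PhiH ::
    "nat \<Rightarrow> complex gvec \<Rightarrow> real gvec \<Rightarrow> (nat \<Rightarrow> complex gvec) \<Rightarrow> nat \<Rightarrow> complex gvec \<Rightarrow> real"
  where
  "PhiH m Q d zs j v =
     1 / 2 * (L2_set (\<lambda>r. cmod (QH Q r * v r - data_projH m Q d zs j r)) (grid (m div 2)))\<^sup>2"

(* Gradient with respect to the real parts plus i times the gradient with respect to the
   imaginary parts. *)

definition cgrad :: "(complex gvec \<Rightarrow> real) \<Rightarrow> complex gvec \<Rightarrow> complex gvec" where
  "cgrad f z i =
     complex_of_real (deriv (\<lambda>x. f (z(i := Complex x (Im (z i))))) (Re (z i))) +
     \<i> * complex_of_real (deriv (\<lambda>y. f (z(i := Complex (Re (z i)) y))) (Im (z i)))"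

definition init_coarse :: "complex gvec \<Rightarrow> complex gvec \<Rightarrow> complex gvec" where
  "init_coarse Q z' = restr (\<lambda>i. complex_of_real (Wz Q i) * z' i)"

definition coarse_prox ::
    "nat \<Rightarrow> complex gvec \<Rightarrow> real gvec \<Rightarrow> real gvec \<Rightarrow> (nat \<Rightarrow> complex gvec) \<Rightarrow> nat \<Rightarrow>
     complex gvec \<Rightarrow> complex gvec \<Rightarrow> bool" where
  "coarse_prox m Q u d zs j z' zh \<longleftrightarrow>
     is_arg_min
       (\<lambda>v. PhiH m Q d zs j v +
          1 / 2 * (\<Sum>r\<in>grid (m div 2). uH Q u r * (cmod (v r - init_coarse Q z' r))\<^sup>2))
       (\<lambda>v. v \<in> cvecs (m div 2)) zh"

end

theory Submission
  imports Defs
begin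

text \<open>
  Write \<open>P\<close> for the bin averages of \<open>\<bar>Q\<bar>\<^sup>2\<close>, and \<open>g = cnj Q * (Q * z' - R)\<close> for the fine
  gradient at \<open>z'\<close>, where \<open>R\<close> is the projected data. The weights are chosen so that the coarse
  residual at the initial point is a multiple of the restricted fine gradient: in the bin \<open>r\<close> both
  \<open>Q\<^sub>H * W\<^sub>z\<close> and \<open>W\<^sub>R\<close> carry the factor \<open>Q\<^sub>H r * cnj Q / P r\<close>, hence the residual is
  \<open>Q\<^sub>H r / P r\<close> times the average of \<open>g\<close> over the bin (\<open>coarse_residual_init\<close>).

  The coarse proximal objective is a sum of one-variable quadratics. Completing the square
  (\<open>complete_square_cmod\<close>) turns it into a weighted squared distance to an explicit centre plus a
  constant. The weights \<open>u\<^sub>H + \<bar>Q\<^sub>H\<bar>\<^sup>2\<close> are positive because they equal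
  \<open>\<bar>Q\<^sub>H\<bar>\<^sup>2 / P\<close> times the bin average of \<open>u + \<bar>Q\<bar>\<^sup>2\<close>, so the centre is the unique minimiser
  (\<open>is_arg_min_weighted_dist_iff\<close>) and its displacement from the initial point is a nonpositive
  real multiple of the restricted gradient. Since prolongation is four times the adjoint of
  restriction (\<open>sum_mult_prolong\<close>), pairing the fine gradient with the prolonged displacement gives
  minus a weighted sum of squared moduli of restricted gradient entries.
\<close>

section \<open>Transfer between the grids\<close>

lemma finite_grid: "finite (grid n)"
  by (simp add: grid_def)

lemma bin_subset_grid:
  assumes "even m" "r \<in> grid (m div 2)"
  shows "bin r \<subseteq> grid m"
  using assms by (auto simp: grid_def bin_def elim!: evenE)

lemma bin_of_in_grid:
  assumes "even m" "i \<in> grid m"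
  shows "bin_of i \<in> grid (m div 2)"
  using assms by (auto simp: grid_def bin_of_def elim!: evenE)

lemma restr_cong:
  assumes "\<And>i. i \<in> bin r \<Longrightarrow> v i = w i"
  shows "restr v r = restr w r"
  using assms by (simp add: restr_def cong: sum.cong)

lemma restr_add: "restr (\<lambda>i. v i + w i) r = restr v r + restr w r"
  by (simp add: restr_def sum.distrib distrib_left)

lemma restr_diff: "restr (\<lambda>i. v i - w i) r = restr v r - restr w r"
  by (simp add: restr_def sum_subtractf right_diff_distrib)

lemma restr_mult_left: "restr (\<lambda>i. c * w i) r = c * restr w r"
  by (simp add: restr_def sum_distrib_left mult_ac)

lemma restr_cnj: "restr (\<lambda>i. cnj (w i)) r = cnj (restr w r)"
  by (simp add: restr_def cnj_sum)

lemma restr_pos: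
  fixes w :: "real gvec"
  assumes "\<And>i. i \<in> bin r \<Longrightarrow> 0 < w i"
  shows "0 < restr w r"
proof -
  have "0 < (\<Sum>i\<in>bin r. w i)"
    by (rule sum_pos) (use assms in \<open>auto simp: bin_def\<close>)
  then show ?thesis by (simp add: restr_def)
qed

lemma restr_abs2_nonneg: "0 \<le> restr (abs2 Q) r"
  by (simp add: restr_def abs2_def sum_nonneg)

text \<open>The bilinear form of the identity between prolongation and four times the adjoint of
  restriction: the fibres of \<open>bin_of\<close> are the bins, and for even \<open>m\<close> they tile the grid.\<close>

lemma sum_mult_prolong:
  fixes a e :: "'a::field_char_0 gvec"
  assumes "even m"
  shows "(\<Sum>i\<in>grid m. a i * prolong e i) = 4 * (\<Sum>r\<in>grid (m div 2). restr a r * e r)"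
proof -
  have fibre: "{i \<in> grid m. bin_of i = r} = bin r" if "r \<in> grid (m div 2)" for r
    using bin_subset_grid[OF assms that] by (auto simp: mem_bin_iff)
  have "(\<Sum>i\<in>grid m. a i * prolong e i)
      = (\<Sum>r\<in>grid (m div 2). \<Sum>i\<in>{i \<in> grid m. bin_of i = r}. a i * prolong e i)"
    using bin_of_in_grid[OF assms] by (intro sum.group[symmetric] finite_grid) auto
  also have "\<dots> = (\<Sum>r\<in>grid (m div 2). 4 * (restr a r * e r))"
  proof (rule sum.cong[OF refl])
    fix r assume r: "r \<in> grid (m div 2)"
    have "(\<Sum>i\<in>bin r. a i * prolong e i) = (\<Sum>i\<in>bin r. a i) * e r"
      unfolding sum_distrib_right by (rule sum.cong) (simp_all add: prolong_def mem_bin_iff)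
    then show "(\<Sum>i\<in>{i \<in> grid m. bin_of i = r}. a i * prolong e i) = 4 * (restr a r * e r)"
      by (simp add: fibre[OF r] restr_def)
  qed
  finally show ?thesis by (simp add: sum_distrib_left)
qed

section \<open>Gradient of the fine surrogate\<close>

lemma cgrad_half_norm_residual:
  assumes A: "finite A" "i \<in> A"
  shows "cgrad (\<lambda>z. 1 / 2 * (L2_set (\<lambda>i. cmod (q i * z i - b i)) A)\<^sup>2) z i
    = cnj (q i) * (q i * z i - b i)"
proof -
  let ?f = "\<lambda>z. 1 / 2 * (L2_set (\<lambda>i. cmod (q i * z i - b i)) A)\<^sup>2"
  define C where "C = 1 / 2 * (\<Sum>l\<in>A - {i}. (cmod (q l * z l - b l))\<^sup>2)"
  \<comment> \<open>Only the summand at \<open>i\<close> depends on the coordinate being varied.\<close>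
  have f: "?f (z(i := Complex x y)) = C + 1 / 2 *
      ((Re (q i) * x - Im (q i) * y - Re (b i))\<^sup>2 + (Re (q i) * y + Im (q i) * x - Im (b i))\<^sup>2)"
    for x y
    using A by (simp add: L2_set_def sum_nonneg sum.remove[of A i] C_def cmod_power2 distrib_left)
  have dx: "deriv (\<lambda>x. ?f (z(i := Complex x (Im (z i))))) (Re (z i)) =
      Re (q i) * (Re (q i) * Re (z i) - Im (q i) * Im (z i) - Re (b i)) +
      Im (q i) * (Re (q i) * Im (z i) + Im (q i) * Re (z i) - Im (b i))"
    unfolding f
    by (rule DERIV_imp_deriv) (auto intro!: derivative_eq_intros simp: field_simps)
  have dy: "deriv (\<lambda>y. ?f (z(i := Complex (Re (z i)) y))) (Im (z i)) =
      - Im (q i) * (Re (q i) * Re (z i) - Im (q i) * Im (z i) - Re (b i)) +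
      Re (q i) * (Re (q i) * Im (z i) + Im (q i) * Re (z i) - Im (b i))"
    unfolding f
    by (rule DERIV_imp_deriv) (auto intro!: derivative_eq_intros simp: field_simps)
  show ?thesis
    unfolding cgrad_def dx dy by (simp add: complex_eq_iff algebra_simps)
qed

lemma cgrad_Phi:
  assumes "i \<in> grid m"
  shows "cgrad (Phi m Q d zs j) z i = cnj (Q i) * (Q i * z i - data_proj m Q d zs j i)"
proof -
  have "Phi m Q d zs j =
      (\<lambda>z. 1 / 2 * (L2_set (\<lambda>i. cmod (Q i * z i - data_proj m Q d zs j i)) (grid m))\<^sup>2)"
    by (simp add: fun_eq_iff Phi_def)
  then show ?thesis
    using cgrad_half_norm_residual[OF finite_grid assms] by simp
qed

section \<open>The coarse proximal problem\<close>

text \<open>Within a bin, \<open>Q\<^sub>H * W\<^sub>z\<close> is \<open>Q\<^sub>H r / P r * cnj Q\<close> times \<open>Q\<close>, and \<open>W\<^sub>R\<close> is the same factor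
  without \<open>Q\<close>. So the average is taken of \<open>cnj Q\<close> times the fine residual, which is the fine
  gradient.\<close>

lemma coarse_residual_init:
  assumes "even m" "r \<in> grid (m div 2)"
  shows "QH Q r * init_coarse Q z' r - data_projH m Q d zs j r
    = QH Q r / complex_of_real (restr (abs2 Q) r) * restr (cgrad (Phi m Q d zs j) z') r"
proof -
  have "QH Q r * init_coarse Q z' r - data_projH m Q d zs j r =
      restr (\<lambda>i. QH Q r * (complex_of_real (Wz Q i) * z' i) - WR Q i * data_proj m Q d zs j i) r"
    by (simp add: init_coarse_def data_projH_def restr_diff restr_mult_left)
  also have "\<dots> = restr (\<lambda>i. QH Q r / complex_of_real (restr (abs2 Q) r) *
      cgrad (Phi m Q d zs j) z' i) r"
  proof (rule restr_cong)
    fix i assume i: "i \<in> bin r"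
    then have ig: "i \<in> grid m" and r: "bin_of i = r"
      using bin_subset_grid[OF assms] by (auto simp: mem_bin_iff)
    have "complex_of_real (abs2 Q i) = Q i * cnj (Q i)"
      by (simp only: abs2_def complex_norm_square)
    then show "QH Q r * (complex_of_real (Wz Q i) * z' i) - WR Q i * data_proj m Q d zs j i =
        QH Q r / complex_of_real (restr (abs2 Q) r) * cgrad (Phi m Q d zs j) z' i"
      by (simp add: cgrad_Phi[OF ig] Wz_def WR_def prolong_def r right_diff_distrib mult_ac
          diff_divide_distrib)
  qed
  finally show ?thesis by (simp only: restr_mult_left)
qed

text \<open>The regularisation weight may be negative in some bins: only its sum with \<open>\<bar>Q\<^sub>H\<bar>\<^sup>2\<close> has a
  sign, since it equals \<open>\<bar>Q\<^sub>H\<bar>\<^sup>2 / P\<close> times the average of \<open>u + \<bar>Q\<bar>\<^sup>2\<close>.\<close>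

lemma uH_plus_abs2_QH_pos:
  assumes "\<And>i. i \<in> bin r \<Longrightarrow> 0 < u i + abs2 Q i"
    and "restr (abs2 Q) r \<noteq> 0"
    and "uH Q u r + abs2 (QH Q) r \<noteq> 0"
  shows "0 < uH Q u r + abs2 (QH Q) r"
proof -
  have "uH Q u r + abs2 (QH Q) r
      = abs2 (QH Q) r * (restr (\<lambda>i. u i + abs2 Q i) r / restr (abs2 Q) r)"
    using assms(2) by (simp add: uH_def WuH_def restr_add field_simps)
  moreover have "0 \<le> \<dots>"
    using restr_pos[of r "\<lambda>i. u i + abs2 Q i", OF assms(1)] restr_abs2_nonneg[of Q r]
    by (intro mult_nonneg_nonneg divide_nonneg_nonneg) (auto simp: abs2_def[of "QH Q"])
  ultimately show ?thesis using assms(3) by linarith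
qed

lemma complete_square_cmod:
  fixes a c e :: complex and s :: real
  assumes "s + (cmod a)\<^sup>2 \<noteq> 0"
  shows "(cmod (a * e + c))\<^sup>2 + s * (cmod e)\<^sup>2 =
    (s + (cmod a)\<^sup>2) * (cmod (e + cnj a * c / complex_of_real (s + (cmod a)\<^sup>2)))\<^sup>2 +
    s * (cmod c)\<^sup>2 / (s + (cmod a)\<^sup>2)"
proof -
  define t where "t = s + (cmod a)\<^sup>2"
  define w where "w = cnj a * c"
  have t: "t \<noteq> 0" using assms by (simp add: t_def)
  have w2: "(cmod w)\<^sup>2 = (t - s) * (cmod c)\<^sup>2"
    by (simp add: w_def t_def norm_mult power_mult_distrib)
  have "(cmod (a * e + c))\<^sup>2 = (t - s) * (cmod e)\<^sup>2 + 2 * Re (e * cnj w) + (cmod c)\<^sup>2"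
    by (simp add: t_def w_def cmod_power2) (simp add: power2_eq_square algebra_simps)
  moreover have "(cmod (e + w / complex_of_real t))\<^sup>2 =
      (t\<^sup>2 * (cmod e)\<^sup>2 + 2 * t * Re (e * cnj w) + (cmod w)\<^sup>2) / t\<^sup>2"
  proof -
    have "e + w / complex_of_real t = (complex_of_real t * e + w) / complex_of_real t"
      using t by (simp add: field_simps)
    then have "(cmod (e + w / complex_of_real t))\<^sup>2 = (cmod (complex_of_real t * e + w))\<^sup>2 / t\<^sup>2"
      by (simp add: norm_divide power_divide)
    also have "(cmod (complex_of_real t * e + w))\<^sup>2 =
        t\<^sup>2 * (cmod e)\<^sup>2 + 2 * t * Re (e * cnj w) + (cmod w)\<^sup>2"
      by (simp add: cmod_power2) (simp add: power2_eq_square algebra_simps)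
    finally show ?thesis .
  qed
  ultimately show ?thesis
    using t unfolding t_def[symmetric] w_def[symmetric] w2
    by (simp add: field_simps power2_eq_square)
qed

lemma is_arg_min_weighted_dist_iff:
  fixes c :: "'b \<Rightarrow> 'c::real_normed_vector"
  assumes A: "finite A" and s: "\<And>r. r \<in> A \<Longrightarrow> 0 < s r"
    and f: "\<And>v. f v = K + (\<Sum>r\<in>A. s r * (norm (v r - c r))\<^sup>2)"
  shows "is_arg_min f (\<lambda>v. v \<in> A \<rightarrow>\<^sub>E UNIV) v \<longleftrightarrow> v = restrict c A"
proof -
  have min: "f (restrict c A) = K"
    by (simp add: f)
  have above: "K \<le> f v" for v
    using s by (auto simp: f less_imp_le intro!: sum_nonneg mult_nonneg_nonneg)
  have eq: "v = restrict c A" if "v \<in> A \<rightarrow>\<^sub>E UNIV" "f v \<le> K" for v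
  proof -
    have "(\<Sum>r\<in>A. s r * (norm (v r - c r))\<^sup>2) = 0"
      using that(2) above[of v] by (simp add: f)
    then have "\<forall>r\<in>A. s r * (norm (v r - c r))\<^sup>2 = 0"
      using A s by (subst (asm) sum_nonneg_eq_0_iff) (auto simp: less_imp_le)
    then have "v r = c r" if "r \<in> A" for r
      using s that by fastforce
    then show ?thesis
      using that(1) by (intro PiE_ext[of _ A "\<lambda>_. UNIV"]) auto
  qed
  show ?thesis
  proof
    assume "is_arg_min f (\<lambda>v. v \<in> A \<rightarrow>\<^sub>E UNIV) v"
    then have v: "v \<in> A \<rightarrow>\<^sub>E UNIV" and "\<not> f (restrict c A) < f v"
      by (auto simp: is_arg_min_def)
    then show "v = restrict c A"
      using eq[OF v] min by simp
  next
    assume "v = restrict c A"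
    then show "is_arg_min f (\<lambda>v. v \<in> A \<rightarrow>\<^sub>E UNIV) v"
      using above min by (auto simp: is_arg_min_def not_less)
  qed
qed

text \<open>With \<open>a = Q\<^sub>H r\<close> and \<open>c = Q\<^sub>H r / P r * restr g r\<close>, the centre \<open>- cnj a * c / t\<close> of the
  completed square is the displacement of the explicit formula.\<close>

lemma coarse_prox_iff:
  fixes m j :: nat and Q z' :: "complex gvec" and u d :: "real gvec"
    and zs :: "nat \<Rightarrow> complex gvec"
  assumes m: "even m"
    and u: "\<And>i. i \<in> grid m \<Longrightarrow> 0 < u i + abs2 Q i"
    and P: "\<And>r. r \<in> grid (m div 2) \<Longrightarrow> restr (abs2 Q) r \<noteq> 0"
    and t: "\<And>r. r \<in> grid (m div 2) \<Longrightarrow> uH Q u r + abs2 (QH Q) r \<noteq> 0"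
  defines "g \<equiv> cgrad (Phi m Q d zs j) z'"
  shows "coarse_prox m Q u d zs j z' zh \<longleftrightarrow>
    zh = (\<lambda>r\<in>grid (m div 2). init_coarse Q z' r - complex_of_real
      (abs2 (QH Q) r / restr (abs2 Q) r / (uH Q u r + abs2 (QH Q) r)) * restr g r)"
    (is "_ \<longleftrightarrow> zh = restrict ?c _")
proof -
  let ?G = "grid (m div 2)"
  let ?t = "\<lambda>r. uH Q u r + abs2 (QH Q) r"
  let ?res = "\<lambda>r. QH Q r / complex_of_real (restr (abs2 Q) r) * restr g r"
  let ?K = "\<lambda>r. uH Q u r * (cmod (?res r))\<^sup>2 / ?t r"
  let ?F = "\<lambda>v. PhiH m Q d zs j v +
    1 / 2 * (\<Sum>r\<in>?G. uH Q u r * (cmod (v r - init_coarse Q z' r))\<^sup>2)"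
  have pos: "0 < ?t r" if "r \<in> ?G" for r
    using uH_plus_abs2_QH_pos[OF u P[OF that] t[OF that]] bin_subset_grid[OF m that] by blast
  have summand: "(cmod (QH Q r * v r - data_projH m Q d zs j r))\<^sup>2 +
      uH Q u r * (cmod (v r - init_coarse Q z' r))\<^sup>2 = ?t r * (cmod (v r - ?c r))\<^sup>2 + ?K r"
    if r: "r \<in> ?G" for r v
  proof -
    let ?e = "v r - init_coarse Q z' r"
    have "QH Q r * v r - data_projH m Q d zs j r = QH Q r * ?e + ?res r"
      using coarse_residual_init[OF m r, of Q z' d zs j] by (simp add: g_def algebra_simps)
    moreover have "cnj (QH Q r) * ?res r / complex_of_real (?t r) = complex_of_real
        (abs2 (QH Q) r / restr (abs2 Q) r / ?t r) * restr g r"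
      by (simp add: abs2_def complex_norm_square mult_ac del: of_real_power)
    then have "v r - ?c r = ?e + cnj (QH Q r) * ?res r / complex_of_real (?t r)"
      by (simp only: diff_diff_eq2 add_diff_eq diff_add_eq)
    moreover note complete_square_cmod[of "uH Q u r" "QH Q r" ?e "?res r"] t[OF r]
    ultimately show ?thesis by (simp only: abs2_def simp_thms)
  qed
  have F: "?F v = 1 / 2 * (\<Sum>r\<in>?G. ?K r) + (\<Sum>r\<in>?G. 1 / 2 * ?t r * (cmod (v r - ?c r))\<^sup>2)" for v
  proof -
    have "?F v = 1 / 2 * (\<Sum>r\<in>?G. (cmod (QH Q r * v r - data_projH m Q d zs j r))\<^sup>2 +
        uH Q u r * (cmod (v r - init_coarse Q z' r))\<^sup>2)"
      by (simp add: PhiH_def L2_set_def sum_nonneg sum.distrib distrib_left)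
    also have "\<dots> = 1 / 2 * (\<Sum>r\<in>?G. ?t r * (cmod (v r - ?c r))\<^sup>2 + ?K r)"
      by (simp only: summand cong: sum.cong)
    also have "\<dots> = 1 / 2 * (\<Sum>r\<in>?G. ?K r) + (\<Sum>r\<in>?G. 1 / 2 * ?t r * (cmod (v r - ?c r))\<^sup>2)"
      unfolding sum.distrib distrib_left[of _ "sum f A" for f A] sum_distrib_left mult.assoc
      by (rule add.commute)
    finally show ?thesis .
  qed
  show ?thesis
    unfolding coarse_prox_def cvecs_def
    by (rule is_arg_min_weighted_dist_iff[where s = "\<lambda>r. 1 / 2 * ?t r", OF finite_grid _ F])
      (use pos in simp)
qed

section \<open>Descent direction\<close>

text \<open>By adjointness the pairing is four times a coarse sum, and a displacement that is a
  nonpositive multiple of the restricted gradient makes each of its terms a nonpositive multiple of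
  a squared modulus; in particular the pairing is real.\<close>

lemma prolong_descent:
  fixes g e :: "complex gvec" and w :: "real gvec"
  assumes m: "even m"
    and w: "\<And>r. r \<in> grid (m div 2) \<Longrightarrow> 0 \<le> w r"
    and e: "\<And>r. r \<in> grid (m div 2) \<Longrightarrow> e r = - complex_of_real (w r) * restr g r"
  shows "(\<Sum>i\<in>grid m. cnj (g i) * prolong e i) \<le> 0"
proof -
  have "(\<Sum>i\<in>grid m. cnj (g i) * prolong e i)
      = 4 * (\<Sum>r\<in>grid (m div 2). cnj (restr g r) * e r)"
    using sum_mult_prolong[OF m, of "\<lambda>i. cnj (g i)" e] by (simp add: restr_cnj)
  also have "\<dots> = 4 * (\<Sum>r\<in>grid (m div 2). - complex_of_real (w r * (cmod (restr g r))\<^sup>2))"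
    by (simp add: e complex_norm_square mult_ac del: of_real_power cong: sum.cong)
  also have "\<dots> = complex_of_real (- 4 * (\<Sum>r\<in>grid (m div 2). w r * (cmod (restr g r))\<^sup>2))"
    by (simp add: sum_negf)
  also have "\<dots> \<le> complex_of_real 0"
  proof -
    have "0 \<le> (\<Sum>r\<in>grid (m div 2). w r * (cmod (restr g r))\<^sup>2)"
      using w by (intro sum_nonneg mult_nonneg_nonneg) auto
    then show ?thesis by (simp add: less_eq_complex_def del: of_real_mult)
  qed
  finally show ?thesis by simp
qed

theorem theorem4p3:
  fixes m j :: nat
    and k :: 'k
    and Q z' :: "complex gvec"
    and u :: "real gvec"
    and d :: "'k \<Rightarrow> real gvec"
    and z :: "'k \<Rightarrow> nat \<Rightarrow> complex gvec"
  assumes "even m"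
    and "\<And>i. i \<in> grid m \<Longrightarrow> 0 \<le> d k i"
    and "\<And>i. i \<in> grid m \<Longrightarrow> 0 < u i + abs2 Q i"
    and "\<And>r. r \<in> grid (m div 2) \<Longrightarrow> restr (abs2 Q) r \<noteq> 0"
    and "\<And>r. r \<in> grid (m div 2) \<Longrightarrow> uH Q u r + abs2 (QH Q) r \<noteq> 0"
  shows "(\<exists>!zh. coarse_prox m Q u (d k) (z k) j z' zh) \<and>
    (\<forall>zh. coarse_prox m Q u (d k) (z k) j z' zh \<longrightarrow>
      (let g = cgrad (Phi m Q (d k) (z k) j) z';
           e = (\<lambda>r. zh r - init_coarse Q z' r)
       in (\<Sum>i\<in>grid m. cnj (g i) * prolong e i) \<le> 0 \<and>
          (\<forall>r\<in>grid (m div 2).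
             e r = - complex_of_real
                       (abs2 (QH Q) r / restr (abs2 Q) r / (uH Q u r + abs2 (QH Q) r)) *
                   restr g r)))"
proof -
  let ?g = "cgrad (Phi m Q (d k) (z k) j) z'"
  let ?t = "\<lambda>r. uH Q u r + abs2 (QH Q) r"
  let ?w = "\<lambda>r. abs2 (QH Q) r / restr (abs2 Q) r / ?t r"
  note iff = coarse_prox_iff[where d = "d k" and zs = "z k" and j = j and z' = z',
      OF assms(1,3,4,5)]
  have w: "0 \<le> ?w r" if r: "r \<in> grid (m div 2)" for r
  proof -
    have "0 < ?t r"
      using uH_plus_abs2_QH_pos[OF assms(3) assms(4)[OF r] assms(5)[OF r]]
        bin_subset_grid[OF assms(1) r] by blast
    then show ?thesis
      using restr_abs2_nonneg[of Q r] by (simp add: abs2_def)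
  qed
  have e: "zh r - init_coarse Q z' r = - complex_of_real (?w r) * restr ?g r"
    if "coarse_prox m Q u (d k) (z k) j z' zh" "r \<in> grid (m div 2)" for zh r
    using that by (simp add: iff)
  show ?thesis
    unfolding Let_def
  proof (intro conjI allI impI ballI)
    show "\<exists>!zh. coarse_prox m Q u (d k) (z k) j z' zh"
      by (simp add: iff)
  next
    fix zh assume zh: "coarse_prox m Q u (d k) (z k) j z' zh"
    show "(\<Sum>i\<in>grid m. cnj (?g i) * prolong (\<lambda>r. zh r - init_coarse Q z' r) i) \<le> 0"
      using w e[OF zh] by (rule prolong_descent[OF assms(1)])
  qed (rule e)
qed

end
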